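(* Let $1\leq m\leq n/2$. The sets $$T(n,m)\times\prod_{X\in B(n)_{m-1}}\mathcal{DU}(X)\qquad\text{and}\qquad T(n,m-1)\times\prod_{X\in B(n)_m}\mathcal{UD}(X)$$ have the same cardinality.
   Context: $B(n)_k$ is the set of $k$-element subsets of $\{1,\ldots,n\}$. For $0\leq m\leq n/2$, the Johnson graph $C(n,m)$ has vertex set $B(n)_m$, with $X,Y$ adjacent iff $|X\cap Y|=m-1$. A rooted spanning tree of a graph is a spanning tree together with a choice of a vertex as root; $T(n,m)$ is the set of rooted spanning trees of $C(n,m)$. For $1\leq k\leq n$, $X\in B(n)_k$, $X'\in B(n)_{k-1}$: $\mathcal{UD}(X)=\{(Y,Z)\in B(n)_{k-1}\times B(n)_k: X\supseteq Y\subseteq Z\}$ and $\mathcal{DU}(X')=\{(Y',Z')\in B(n)_k\times B(n)_{k-1}: X'\subseteq Y'\supseteq Z'\}$. The products are Cartesian products. *)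

theory Defs
  imports Main "HOL-Library.FuncSet" "HOL-Library.Equipollence"
begin

text \<open>
  A finite simple undirected graph is given by its vertex set \<open>V\<close> and its edge set \<open>E\<close>, a set of
  two-element subsets of \<open>V\<close>.
\<close>

definition connected_graph :: "'a set \<Rightarrow> 'a set set \<Rightarrow> bool" where
  "connected_graph V E \<longleftrightarrow>
     V \<noteq> {} \<and> (\<forall>u\<in>V. \<forall>v\<in>V. (u, v) \<in> {(x, y). x \<in> V \<and> y \<in> V \<and> {x, y} \<in> E}\<^sup>*)"

definition graph_cycle :: "'a set set \<Rightarrow> 'a list \<Rightarrow> bool" where
  "graph_cycle E c \<longleftrightarrow>
     length c \<ge> 3 \<and> distinct c \<and>
     (\<forall>i<length c. {c ! i, c ! (Suc i mod length c)} \<in> E)"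

definition is_tree :: "'a set \<Rightarrow> 'a set set \<Rightarrow> bool" where
  "is_tree V E \<longleftrightarrow> connected_graph V E \<and> (\<nexists>c. graph_cycle E c)"

text \<open>A spanning tree has the same vertex set as the graph, so it is determined by its edges.\<close>

definition spanning_tree :: "'a set \<Rightarrow> 'a set set \<Rightarrow> 'a set set \<Rightarrow> bool" where
  "spanning_tree V E F \<longleftrightarrow> F \<subseteq> E \<and> is_tree V F"

definition rooted_spanning_trees :: "'a set \<Rightarrow> 'a set set \<Rightarrow> ('a set set \<times> 'a) set" where
  "rooted_spanning_trees V E = {(F, r). spanning_tree V E F \<and> r \<in> V}"

definition B :: "nat \<Rightarrow> nat \<Rightarrow> nat set set" where
  "B n k = {X. X \<subseteq> {1..n} \<and> card X = k}"

text \<open>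
  The intersection condition is stated over the integers: with truncated subtraction, the
  single vertex \<open>{}\<close> of the graph for \<open>m = 0\<close> would be adjacent to itself.
\<close>

definition johnson_edges :: "nat \<Rightarrow> nat \<Rightarrow> nat set set set" where
  "johnson_edges n m =
     {{X, Y} | X Y. X \<in> B n m \<and> Y \<in> B n m \<and> int (card (X \<inter> Y)) = int m - 1}"

lemma card_johnson_edge:
  assumes "e \<in> johnson_edges n m"
  shows "e \<subseteq> B n m" and "card e = 2"
proof -
  obtain X Y where e: "e = {X, Y}" "X \<in> B n m" "Y \<in> B n m" "int (card (X \<inter> Y)) = int m - 1"
    using assms by (auto simp: johnson_edges_def)
  then have "X \<noteq> Y"
    by (auto simp: B_def)
  with e show "e \<subseteq> B n m" "card e = 2"
    by auto
qed

definition T :: "nat \<Rightarrow> nat \<Rightarrow> (nat set set set \<times> nat set) set" where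
  "T n m = rooted_spanning_trees (B n m) (johnson_edges n m)"

text \<open>
  Both definitions below are meant for \<open>1 \<le> k \<le> n\<close>, with \<open>X\<close> in \<open>B n k\<close> for \<open>UD\<close> and in
  \<open>B n (k - 1)\<close> for \<open>DU\<close>.
\<close>

definition UD :: "nat \<Rightarrow> nat \<Rightarrow> nat set \<Rightarrow> (nat set \<times> nat set) set" where
  "UD n k X = {(Y, Z) \<in> B n (k - 1) \<times> B n k. X \<supseteq> Y \<and> Y \<subseteq> Z}"

definition DU :: "nat \<Rightarrow> nat \<Rightarrow> nat set \<Rightarrow> (nat set \<times> nat set) set" where
  "DU n k X = {(Y, Z) \<in> B n k \<times> B n (k - 1). X \<subseteq> Y \<and> Y \<supseteq> Z}"

end

theory Submission
  imports
    Defs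
    "Jordan_Normal_Form.Determinant"
    "HOL-Computational_Algebra.Polynomial"
    "HOL-Library.Countable_Set"
    "HOL-Library.Transitive_Closure_Table"
begin

text \<open>
  Inclusion makes \<open>B n m\<close> and \<open>B n (m - 1)\<close> the points and lines of a partial linear space with
  \<open>r = m\<close> lines through every point and \<open>k = n - m + 1\<close> points on every line; the two Johnson
  graphs are its collinearity graph and that of the dual space. With the incidence matrix \<open>W\<close>, the
  Laplacians of these graphs are \<open>r k I - W W\<^sup>T\<close> and \<open>r k I - W\<^sup>T W\<close>, so Sylvester's determinant
  identity relates the polynomials \<open>det (x I + L)\<close> up to powers of \<open>x + r k\<close>. These polynomials
  count rooted spanning forests by their number of roots, and the coefficients of \<open>x\<close> count rooted
  spanning trees. The powers of \<open>r k\<close> that remain are the cardinalities of the two products, as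
  every \<open>UD n m X\<close> and \<open>DU n m X\<close> has \<open>r k\<close> elements.
\<close>

section \<open>Parent functions and rooted spanning trees\<close>

definition adjacency :: "'a set \<Rightarrow> 'a set set \<Rightarrow> ('a \<times> 'a) set" where
  "adjacency V E = {(x, y). x \<in> V \<and> y \<in> V \<and> {x, y} \<in> E}"

lemma connected_graph_iff_adjacency:
  "connected_graph V E \<longleftrightarrow> V \<noteq> {} \<and> (\<forall>u\<in>V. \<forall>v\<in>V. (u, v) \<in> (adjacency V E)\<^sup>*)"
  by (simp add: connected_graph_def adjacency_def)

lemma sym_adjacency: "sym (adjacency V E)"
  by (auto simp: adjacency_def sym_def insert_commute)

lemma rtrancl_distinct_path:
  assumes "(x, y) \<in> R\<^sup>*"
  obtains vs where "distinct (x # vs)" "last (x # vs) = y"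
    "\<And>i. i < length vs \<Longrightarrow> ((x # vs) ! i, vs ! i) \<in> R"
proof -
  let ?R = "\<lambda>u v. (u, v) \<in> R"
  have "?R\<^sup>*\<^sup>* x y"
    using assms by (simp add: rtranclp_rtrancl_eq)
  then obtain ws where "rtrancl_path ?R x ws y"
    by (auto simp: rtranclp_eq_rtrancl_path)
  then obtain vs where vs: "rtrancl_path ?R x vs y" "distinct (x # vs)"
    by (rule rtrancl_path_distinct)
  moreover have "last (x # vs) = y"
    using vs(1) rtrancl_path_last[OF vs(1)] by (auto elim: rtrancl_path.cases)
  ultimately show thesis
    using that rtrancl_path_nth[OF vs(1)] by blast
qed

lemma graph_cycle_if_connected_ends:
  assumes conn: "(x, y) \<in> (adjacency V F')\<^sup>*" and "F' \<subseteq> F"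
    and xy: "x \<noteq> y" "{x, y} \<in> F" "{x, y} \<notin> F'"
  shows "\<exists>c. graph_cycle F c"
proof -
  obtain vs where distinct: "distinct (x # vs)" and last: "last (x # vs) = y"
    and path: "\<And>i. i < length vs \<Longrightarrow> ((x # vs) ! i, vs ! i) \<in> adjacency V F'"
    using rtrancl_distinct_path[OF conn] by blast
  have "vs \<noteq> []"
    using last xy(1) by auto
  with last have last_nth: "vs ! (length vs - 1) = y"
    by (simp add: last_conv_nth)
  have edge: "{(x # vs) ! i, vs ! i} \<in> F'" if "i < length vs" for i
    using path[OF that] by (simp add: adjacency_def)
  have "length vs \<noteq> 1"
    using edge[of 0] last_nth xy(3) \<open>vs \<noteq> []\<close> by auto
  then have "length (x # vs) \<ge> 3"
    using \<open>vs \<noteq> []\<close> by (cases vs) (auto simp: Suc_le_eq)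
  moreover have "{(x # vs) ! i, (x # vs) ! (Suc i mod length (x # vs))} \<in> F"
    if "i < length (x # vs)" for i
  proof (cases "i = length vs")
    case True
    with \<open>vs \<noteq> []\<close> last_nth xy(2) show ?thesis
      by (simp add: insert_commute nth_Cons')
  next
    case False
    with that edge[of i] \<open>F' \<subseteq> F\<close> show ?thesis
      by auto
  qed
  ultimately show ?thesis
    using distinct unfolding graph_cycle_def by blast
qed

lemma acyclic_graph_eq_if_connected_subset:
  assumes conn: "connected_graph V F'" and "F' \<subseteq> F" and acyclic: "\<nexists>c. graph_cycle F c"
    and edges: "\<And>e. e \<in> F \<Longrightarrow> e \<subseteq> V \<and> card e = 2"
  shows "F' = F"
proof
  show "F \<subseteq> F'"
  proof (rule ccontr)
    assume "\<not> F \<subseteq> F'"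
    then obtain e where e: "e \<in> F" "e \<notin> F'"
      by blast
    then have "e \<subseteq> V" "card e = 2"
      using edges by auto
    then obtain x y where xy: "e = {x, y}" "x \<noteq> y"
      by (auto simp: card_2_iff)
    with \<open>e \<subseteq> V\<close> conn have "(x, y) \<in> (adjacency V F')\<^sup>*"
      by (auto simp: connected_graph_iff_adjacency)
    from graph_cycle_if_connected_ends[OF this \<open>F' \<subseteq> F\<close>] e xy acyclic show False
      by blast
  qed
qed fact

text \<open>A rooted forest is encoded by its parent function, with value \<open>None\<close> at the roots.\<close>

definition parent_choices :: "'a set \<Rightarrow> 'a set set \<Rightarrow> 'a \<Rightarrow> 'a option set" where
  "parent_choices V E v = insert None (Some ` {u \<in> V. {v, u} \<in> E})"

definition parent_funs :: "'a set \<Rightarrow> 'a set set \<Rightarrow> ('a \<Rightarrow> 'a option) set" where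
  "parent_funs V E = (\<Pi>\<^sub>E v\<in>V. parent_choices V E v)"

definition parent_rel :: "'a set \<Rightarrow> ('a \<Rightarrow> 'a option) \<Rightarrow> ('a \<times> 'a) set" where
  "parent_rel V f = {(u, v). v \<in> V \<and> f v = Some u}"

definition parent_edges :: "'a set \<Rightarrow> ('a \<Rightarrow> 'a option) \<Rightarrow> 'a set set" where
  "parent_edges V f = {{v, u} | v u. (u, v) \<in> parent_rel V f}"

definition roots :: "'a set \<Rightarrow> ('a \<Rightarrow> 'a option) \<Rightarrow> 'a set" where
  "roots V f = {v \<in> V. f v = None}"

definition rooted_forests :: "'a set \<Rightarrow> 'a set set \<Rightarrow> ('a \<Rightarrow> 'a option) set" where
  "rooted_forests V E = {f \<in> parent_funs V E. wf (parent_rel V f)}"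

definition rooted_trees :: "'a set \<Rightarrow> 'a set set \<Rightarrow> ('a \<Rightarrow> 'a option) set" where
  "rooted_trees V E = {f \<in> rooted_forests V E. card (roots V f) = 1}"

lemma parent_relD:
  assumes "f \<in> parent_funs V E" "(u, v) \<in> parent_rel V f"
  shows "u \<in> V" "v \<in> V" "f v = Some u" "{v, u} \<in> E"
  using assms PiE_mem[of f V _ v]
  by (auto simp: parent_funs_def parent_choices_def parent_rel_def)

lemma parent_funs_mono: "E \<subseteq> E' \<Longrightarrow> parent_funs V E \<subseteq> parent_funs V E'"
  unfolding parent_funs_def by (intro PiE_mono) (auto simp: parent_choices_def)

lemma finite_parent_choices: "finite V \<Longrightarrow> finite (parent_choices V E v)"
  by (simp add: parent_choices_def)

lemma finite_parent_funs: "finite V \<Longrightarrow> finite (parent_funs V E)"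
  unfolding parent_funs_def by (intro finite_PiE finite_parent_choices)

lemma finite_rooted_forests: "finite V \<Longrightarrow> finite (rooted_forests V E)"
  by (simp add: rooted_forests_def finite_parent_funs)

lemma finite_parent_rel:
  assumes "finite V" "f \<in> parent_funs V E"
  shows "finite (parent_rel V f)"
proof (rule finite_subset)
  show "parent_rel V f \<subseteq> V \<times> V"
    using parent_relD[OF assms(2)] by auto
qed (use assms(1) in simp)

lemma parent_edges_subset: "f \<in> parent_funs V E \<Longrightarrow> parent_edges V f \<subseteq> E"
  by (auto simp: parent_edges_def dest: parent_relD)

lemma rooted_forest_reaches_root:
  assumes f: "f \<in> rooted_forests V E" and "v \<in> V"
  shows "\<exists>r\<in>roots V f. (v, r) \<in> (adjacency V (parent_edges V f))\<^sup>*"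
proof -
  have parent_fun: "f \<in> parent_funs V E" and "wf (parent_rel V f)"
    using f by (auto simp: rooted_forests_def)
  from this(2) show ?thesis
    using \<open>v \<in> V\<close>
  proof (induction v rule: wf_induct_rule)
    case (less v)
    show ?case
    proof (cases "f v")
      case None
      with less.prems show ?thesis
        by (auto simp: roots_def)
    next
      case (Some u)
      with less.prems have u: "(u, v) \<in> parent_rel V f"
        by (simp add: parent_rel_def)
      from less.IH[OF u parent_relD(1)[OF parent_fun u]]
      obtain r where "r \<in> roots V f" "(u, r) \<in> (adjacency V (parent_edges V f))\<^sup>*"
        by blast
      moreover have "(v, u) \<in> adjacency V (parent_edges V f)"
        using u parent_relD(1,2)[OF parent_fun u] by (auto simp: adjacency_def parent_edges_def)
      ultimately show ?thesis
        by (meson converse_rtrancl_into_rtrancl)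
    qed
  qed
qed

lemma roots_nonempty:
  assumes "f \<in> rooted_forests V E" "V \<noteq> {}"
  shows "roots V f \<noteq> {}"
  using rooted_forest_reaches_root[OF assms(1)] assms(2) by blast

lemma rooted_tree_connected:
  assumes f: "f \<in> rooted_forests V E" and r: "roots V f = {r}"
  shows "connected_graph V (parent_edges V f)"
proof -
  let ?R = "(adjacency V (parent_edges V f))\<^sup>*"
  have "(v, r) \<in> ?R" if "v \<in> V" for v
    using rooted_forest_reaches_root[OF f that] r by auto
  then have "(u, v) \<in> ?R" if "u \<in> V" "v \<in> V" for u v
    using that sym_rtrancl[OF sym_adjacency] by (meson rtrancl_trans symD)
  moreover have "V \<noteq> {}"
    using r by (auto simp: roots_def)
  ultimately show ?thesis
    by (simp add: connected_graph_iff_adjacency)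
qed

text \<open>A cycle vertex without children on the cycle would have both neighbours as its parent.\<close>

lemma rooted_forest_acyclic:
  assumes "finite V" and f: "f \<in> rooted_forests V E"
  shows "\<nexists>c. graph_cycle (parent_edges V f) c"
proof
  assume "\<exists>c. graph_cycle (parent_edges V f) c"
  then obtain c where len: "length c \<ge> 3" and distinct: "distinct c"
    and edge: "\<And>i. i < length c \<Longrightarrow> {c ! i, c ! (Suc i mod length c)} \<in> parent_edges V f"
    by (auto simp: graph_cycle_def)
  have "finite (parent_rel V f)" "wf (parent_rel V f)"
    using assms finite_parent_rel by (auto simp: rooted_forests_def)
  then have "wf ((parent_rel V f)\<inverse>)"
    by (intro finite_acyclic_wf_converse wf_acyclic)
  moreover have "hd c \<in> set c"
    using len by (intro hd_in_set) auto
  ultimately obtain w where w: "w \<in> set c" "\<And>v. (w, v) \<in> parent_rel V f \<Longrightarrow> v \<notin> set c"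
    by (rule wfE_min[of _ "hd c" "set c"]) auto
  then obtain i where i: "i < length c" "w = c ! i"
    by (auto simp: in_set_conv_nth)
  have parent: "f w = Some (c ! j)" if "j < length c" "{w, c ! j} \<in> parent_edges V f" for j
    using that w(2)[of "c ! j"] by (auto simp: parent_edges_def parent_rel_def doubleton_eq_iff)
  define succ_i where "succ_i = Suc i mod length c"
  define pred_i where "pred_i = (if i = 0 then length c - 1 else i - 1)"
  have neighbours: "succ_i < length c" "pred_i < length c" "succ_i \<noteq> pred_i"
    and succ_pred: "Suc pred_i mod length c = i"
    using len i(1) by (auto simp: succ_i_def pred_i_def mod_Suc)
  have "f w = Some (c ! succ_i)"
    using parent[OF neighbours(1)] edge[OF i(1)] by (simp add: succ_i_def i(2))
  moreover have "f w = Some (c ! pred_i)"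
    using parent[OF neighbours(2)] edge[OF neighbours(2)] succ_pred
    by (simp add: insert_commute i(2))
  ultimately show False
    using neighbours distinct by (simp add: nth_eq_iff_index_eq)
qed

lemma rooted_forest_eqI:
  assumes f: "f \<in> rooted_forests V E" and g: "g \<in> parent_funs V E"
    and roots: "roots V f = roots V g" and edges: "parent_edges V f = parent_edges V g"
  shows "f = g"
proof -
  have parent_fun: "f \<in> parent_funs V E" and wf: "wf (parent_rel V f)"
    using f by (auto simp: rooted_forests_def)
  have "v \<in> V \<longrightarrow> f v = g v" for v
    using wf
  proof (induction v rule: wf_induct_rule)
    case (less v)
    show ?case
    proof (cases "f v")
      case None
      with roots have "v \<in> V \<longrightarrow> v \<in> roots V g"
        by (auto simp: roots_def)
      with None show ?thesis
        by (auto simp: roots_def)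
    next
      case (Some u)
      show ?thesis
      proof
        assume "v \<in> V"
        with Some have u: "(u, v) \<in> parent_rel V f"
          by (simp add: parent_rel_def)
        then have "{v, u} \<in> parent_edges V g"
          unfolding edges[symmetric] by (auto simp: parent_edges_def)
        then have "g v = Some u \<or> g u = Some v"
          by (auto simp: parent_edges_def parent_rel_def doubleton_eq_iff)
        moreover have "f u = g u" "f u \<noteq> Some v"
          using less.IH[OF u] wf_not_sym[OF wf u] parent_relD(1)[OF parent_fun u]
          by (auto simp: parent_rel_def)
        ultimately show "f v = g v"
          using Some by auto
      qed
    qed
  qed
  then show ?thesis
    using parent_fun g by (auto simp: parent_funs_def intro: PiE_ext)
qed

lemma connected_graph_distance:
  assumes "connected_graph V E" "r \<in> V"
  obtains d :: "'a \<Rightarrow> nat"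
  where "\<And>v. v \<in> V \<Longrightarrow> v \<noteq> r \<Longrightarrow> \<exists>u. (v, u) \<in> adjacency V E \<and> d u < d v"
proof
  define d where "d v = (LEAST k. (v, r) \<in> adjacency V E ^^ k)" for v
  fix v assume v: "v \<in> V" "v \<noteq> r"
  have "\<exists>k. (v, r) \<in> adjacency V E ^^ k"
    using assms v by (auto simp: connected_graph_iff_adjacency dest: rtrancl_imp_relpow)
  then have dist: "(v, r) \<in> adjacency V E ^^ d v"
    unfolding d_def by (rule LeastI_ex)
  with v(2) obtain k where k: "d v = Suc k"
    by (cases "d v") auto
  with dist obtain u where u: "(v, u) \<in> adjacency V E" "(u, r) \<in> adjacency V E ^^ k"
    by (metis relpow_Suc_D2)
  from u(2) have "d u \<le> k"
    unfolding d_def by (rule Least_le)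
  with k u(1) show "\<exists>u. (v, u) \<in> adjacency V E \<and> d u < d v"
    by auto
qed

lemma ex_rooted_tree:
  assumes "connected_graph V E" and r: "r \<in> V"
  shows "\<exists>f\<in>rooted_forests V E. roots V f = {r}"
proof -
  obtain d :: "'a \<Rightarrow> nat"
    where "\<And>v. v \<in> V \<Longrightarrow> v \<noteq> r \<Longrightarrow> \<exists>u. (v, u) \<in> adjacency V E \<and> d u < d v"
    using connected_graph_distance[OF assms] by blast
  then obtain p where p: "\<And>v. v \<in> V \<Longrightarrow> v \<noteq> r \<Longrightarrow> (v, p v) \<in> adjacency V E \<and> d (p v) < d v"
    by metis
  define f where "f = (\<lambda>v\<in>V. if v = r then None else Some (p v))"
  have "f \<in> parent_funs V E"
    unfolding parent_funs_def f_def using p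
    by (intro restrict_PiE_iff[THEN iffD2] ballI) (auto simp: adjacency_def parent_choices_def)
  moreover have "parent_rel V f \<subseteq> measure d"
    using p by (auto simp: parent_rel_def f_def split: if_splits)
  ultimately have "f \<in> rooted_forests V E"
    by (auto simp: rooted_forests_def intro: wf_subset)
  moreover have "roots V f = {r}"
    using r by (auto simp: roots_def f_def)
  ultimately show ?thesis
    by blast
qed

lemma rooted_trees_iff:
  "f \<in> rooted_trees V E \<longleftrightarrow> f \<in> rooted_forests V E \<and> (\<exists>r. roots V f = {r})"
  by (auto simp: rooted_trees_def card_1_singleton_iff)

lemma parent_edges_rooted_spanning_tree:
  assumes "finite V" and f: "f \<in> rooted_forests V E" "roots V f = {r}"
  shows "(parent_edges V f, r) \<in> rooted_spanning_trees V E"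
proof -
  have "r \<in> V" "parent_edges V f \<subseteq> E"
    using f parent_edges_subset[of f V E] by (auto simp: roots_def rooted_forests_def)
  with rooted_tree_connected[OF f] rooted_forest_acyclic[OF assms(1) f(1)] show ?thesis
    by (simp add: rooted_spanning_trees_def spanning_tree_def is_tree_def)
qed

lemma ex_rooted_tree_with_parent_edges:
  assumes edges: "\<And>e. e \<in> E \<Longrightarrow> e \<subseteq> V \<and> card e = 2"
    and "(F, r) \<in> rooted_spanning_trees V E"
  shows "\<exists>f\<in>rooted_forests V E. roots V f = {r} \<and> parent_edges V f = F"
proof -
  have F: "F \<subseteq> E" "connected_graph V F" and acyclic: "\<nexists>c. graph_cycle F c" and "r \<in> V"
    using assms(2) by (auto simp: rooted_spanning_trees_def spanning_tree_def is_tree_def)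
  obtain f where f: "f \<in> rooted_forests V F" "roots V f = {r}"
    using ex_rooted_tree[OF F(2) \<open>r \<in> V\<close>] by blast
  have "parent_edges V f = F"
  proof (rule acyclic_graph_eq_if_connected_subset)
    show "connected_graph V (parent_edges V f)"
      by (rule rooted_tree_connected[OF f])
    show "parent_edges V f \<subseteq> F"
      using f(1) by (intro parent_edges_subset) (simp add: rooted_forests_def)
  qed (use acyclic edges F(1) in auto)
  moreover have "f \<in> rooted_forests V E"
    using f(1) parent_funs_mono[OF F(1)] by (auto simp: rooted_forests_def)
  ultimately show ?thesis
    using f(2) by blast
qed

lemma bij_betw_rooted_trees_rooted_spanning_trees:
  assumes "finite V" and edges: "\<And>e. e \<in> E \<Longrightarrow> e \<subseteq> V \<and> card e = 2"
  shows "bij_betw (\<lambda>f. (parent_edges V f, the_elem (roots V f)))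
    (rooted_trees V E) (rooted_spanning_trees V E)"
    (is "bij_betw ?h _ _")
  unfolding bij_betw_def
proof (intro conjI equalityI subsetI)
  show "inj_on ?h (rooted_trees V E)"
    by (rule inj_onI, rule rooted_forest_eqI[where E = E])
      (auto simp: rooted_trees_iff rooted_forests_def)
  show "z \<in> rooted_spanning_trees V E" if "z \<in> ?h ` rooted_trees V E" for z
    using that parent_edges_rooted_spanning_tree[OF assms(1)] by (auto simp: rooted_trees_iff)
  fix z assume "z \<in> rooted_spanning_trees V E"
  then have "\<exists>f\<in>rooted_forests V E. roots V f = {snd z} \<and> parent_edges V f = fst z"
    by (intro ex_rooted_tree_with_parent_edges edges) simp_all
  then obtain f where "f \<in> rooted_forests V E" "roots V f = {snd z}" "parent_edges V f = fst z"
    by blast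
  then show "z \<in> ?h ` rooted_trees V E"
    by (intro image_eqI[of _ _ f]) (auto simp: rooted_trees_iff)
qed

section \<open>Determinants of matrices indexed by finite sets\<close>

definition mat_on :: "'a set \<Rightarrow> 'b set \<Rightarrow> ('a \<Rightarrow> 'b \<Rightarrow> 'c) \<Rightarrow> 'c mat" where
  "mat_on V U F = mat (card V) (card U) (\<lambda>(i, j). F (from_nat_into V i) (from_nat_into U j))"

lemma mat_on_carrier [simp]: "mat_on V U F \<in> carrier_mat (card V) (card U)"
  by (simp add: mat_on_def)

lemma from_nat_into_less_card: "i < card V \<Longrightarrow> from_nat_into V i \<in> V"
  by (intro from_nat_into) auto

lemma mat_on_cong:
  assumes "\<And>v u. v \<in> V \<Longrightarrow> u \<in> U \<Longrightarrow> F v u = G v u"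
  shows "mat_on V U F = mat_on V U G"
  unfolding mat_on_def by (intro cong_mat) (auto simp: assms from_nat_into_less_card)

lemma add_mat_on: "mat_on V U F + mat_on V U G = mat_on V U (\<lambda>v u. F v u + G v u)"
  by (auto simp: mat_on_def)

lemma minus_mat_on: "mat_on V U F - mat_on V U G = mat_on V U (\<lambda>v u. F v u - G v u)"
  by (auto simp: mat_on_def)

lemma mult_mat_on: "mat_on V U F * mat_on U W G = mat_on V W (\<lambda>v w. \<Sum>u\<in>U. F v u * G u w)"
proof (rule eq_matI)
  fix i j
  assume "i < dim_row (mat_on V W (\<lambda>v w. \<Sum>u\<in>U. F v u * G u w))"
    and "j < dim_col (mat_on V W (\<lambda>v w. \<Sum>u\<in>U. F v u * G u w))"
  then show "(mat_on V U F * mat_on U W G) $$ (i, j)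
      = mat_on V W (\<lambda>v w. \<Sum>u\<in>U. F v u * G u w) $$ (i, j)"
    using sum.card_from_nat_into[of "\<lambda>u. F (from_nat_into V i) u * G u (from_nat_into W j)" U]
    by (simp add: mat_on_def scalar_prod_def atLeast0LessThan)
qed (simp_all add: mat_on_def)

lemma smult_one_eq_mat_on:
  assumes "finite V"
  shows "c \<cdot>\<^sub>m 1\<^sub>m (card V) = mat_on V V (\<lambda>v w. c * of_bool (v = w))"
  using bij_betw_from_nat_into_finite[OF assms]
  by (auto simp: mat_on_def bij_betw_def inj_on_eq_iff)

lemma bij_betw_map_permutation:
  assumes "bij_betw h A A'"
  shows "bij_betw (map_permutation A h) {p. p permutes A} {p. p permutes A'}"
proof (rule bij_betw_byWitness[where f' = "map_permutation A' (inv_into A h)"])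
  note inv = bij_betw_inv_into[OF assms]
  show "\<forall>p\<in>{p. p permutes A}. map_permutation A' (inv_into A h) (map_permutation A h p) = p"
    using map_permutation_compose_inv[OF assms] bij_betw_inv_into_left[OF assms] by blast
  show "\<forall>p\<in>{p. p permutes A'}. map_permutation A h (map_permutation A' (inv_into A h) p) = p"
    using map_permutation_compose_inv[OF inv] bij_betw_inv_into_right[OF assms] by blast
qed (use map_permutation_permutes assms bij_betw_inv_into[OF assms] in blast)+

lemma prod_map_permutation:
  assumes h: "bij_betw h A A'"
  shows "(\<Prod>v\<in>A'. F v (map_permutation A h p v)) = (\<Prod>i\<in>A. F (h i) (h (p i)))"
proof -
  have "(\<Prod>v\<in>A'. F v (map_permutation A h p v)) = (\<Prod>i\<in>A. F (h i) (map_permutation A h p (h i)))"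
    by (rule prod.reindex_bij_betw[OF h, symmetric])
  also have "\<dots> = (\<Prod>i\<in>A. F (h i) (h (p i)))"
    using map_permutation_apply[OF bij_betw_imp_inj_on[OF h]] by simp
  finally show ?thesis .
qed

lemma det_mat_on:
  assumes "finite V"
  shows "det (mat_on V V F) = (\<Sum>p | p permutes V. of_int (sign p) * (\<Prod>v\<in>V. F v (p v)))"
proof -
  let ?N = "{0..<card V}" and ?h = "from_nat_into V"
  have h: "bij_betw ?h ?N V"
    using bij_betw_from_nat_into_finite[OF assms] by (simp add: atLeast0LessThan)
  have "det (mat_on V V F)
      = (\<Sum>p | p permutes ?N. of_int (sign p) * (\<Prod>i\<in>?N. mat_on V V F $$ (i, p i)))"
    by (rule det_def') simp
  also have "\<dots> = (\<Sum>p | p permutes ?N. of_int (sign (map_permutation ?N ?h p)) *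
      (\<Prod>v\<in>V. F v (map_permutation ?N ?h p v)))"
  proof (rule sum.cong[OF refl])
    fix p assume "p \<in> {p. p permutes ?N}"
    then have p: "p permutes ?N"
      by simp
    then have "mat_on V V F $$ (i, p i) = F (?h i) (?h (p i))" if "i \<in> ?N" for i
      using that permutes_in_image[OF p, of i] by (simp add: mat_on_def)
    then show "of_int (sign p) * (\<Prod>i\<in>?N. mat_on V V F $$ (i, p i))
        = of_int (sign (map_permutation ?N ?h p)) * (\<Prod>v\<in>V. F v (map_permutation ?N ?h p v))"
      using sign_map_permutation[OF bij_betw_imp_inj_on[OF h] p]
      by (simp add: prod_map_permutation[OF h])
  qed
  also have "\<dots> = (\<Sum>p | p permutes V. of_int (sign p) * (\<Prod>v\<in>V. F v (p v)))"
    by (rule sum.reindex_bij_betw[OF bij_betw_map_permutation[OF h]])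
  finally show ?thesis .
qed

lemma det_mat_on_sum_rows:
  assumes "finite V" "\<And>v. v \<in> V \<Longrightarrow> finite (C v)"
  shows "det (mat_on V V (\<lambda>v w. \<Sum>c\<in>C v. F v c w))
    = (\<Sum>f\<in>Pi\<^sub>E V C. det (mat_on V V (\<lambda>v w. F v (f v) w)))"
proof -
  have "det (mat_on V V (\<lambda>v w. \<Sum>c\<in>C v. F v c w))
      = (\<Sum>p | p permutes V. \<Sum>f\<in>Pi\<^sub>E V C. of_int (sign p) * (\<Prod>v\<in>V. F v (f v) (p v)))"
    using assms by (simp add: det_mat_on prod_sum_PiE sum_distrib_left)
  also have "\<dots> = (\<Sum>f\<in>Pi\<^sub>E V C. det (mat_on V V (\<lambda>v w. F v (f v) w)))"
    using assms(1) by (subst sum.swap) (simp add: det_mat_on)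
  finally show ?thesis .
qed

lemma det_mat_on_smult_rows:
  assumes "finite V"
  shows "det (mat_on V V (\<lambda>v w. c v * F v w)) = prod c V * det (mat_on V V F)"
  using assms by (simp add: det_mat_on prod.distrib sum_distrib_left mult.left_commute)

lemma permutes_eq_id_if_wf:
  assumes "wf r" "p permutes V" and descends: "\<And>v. v \<in> V \<Longrightarrow> p v \<noteq> v \<Longrightarrow> (p v, v) \<in> r"
  shows "p = id"
proof
  fix v
  show "p v = id v"
    using assms(1)
  proof (induction v rule: wf_induct_rule)
    case (less v)
    show ?case
    proof (rule ccontr)
      assume "p v \<noteq> id v"
      then have "(p v, v) \<in> r"
        using descends permutes_not_in[OF assms(2)] by fastforce
      then have "p (p v) = p v"
        using less.IH by simp
      then show False
        using permutes_inj[OF assms(2)] \<open>p v \<noteq> id v\<close> by (simp add: inj_eq)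
    qed
  qed
qed

lemma det_mat_on_triangular:
  assumes "finite V" "wf r"
    and triangular: "\<And>v w. v \<in> V \<Longrightarrow> w \<in> V \<Longrightarrow> v \<noteq> w \<Longrightarrow> (w, v) \<notin> r \<Longrightarrow> F v w = 0"
  shows "det (mat_on V V F) = (\<Prod>v\<in>V. F v v)"
proof -
  have zero: "(\<Prod>v\<in>V. F v (p v)) = 0" if p: "p permutes V" "p \<noteq> id" for p
  proof -
    obtain v where v: "v \<in> V" "p v \<noteq> v" "(p v, v) \<notin> r"
      using permutes_eq_id_if_wf[OF assms(2) p(1)] p(2) by blast
    then have "F v (p v) = 0"
      using triangular permutes_in_image[OF p(1)] by metis
    with assms(1) v(1) show ?thesis
      by (intro prod_zero) auto
  qed
  have "det (mat_on V V F) = (\<Sum>p\<in>{id}. of_int (sign p) * (\<Prod>v\<in>V. F v (p v)))"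
    unfolding det_mat_on[OF assms(1)] using zero assms(1)
    by (intro sum.mono_neutral_right) (auto simp: finite_permutations permutes_id)
  then show ?thesis
    by simp
qed

lemma det_mat_on_eq_0:
  fixes F :: "'a \<Rightarrow> 'a \<Rightarrow> 'b :: idom"
  assumes "finite V" "v \<in> V" "x v \<noteq> 0" and kernel: "\<And>v. v \<in> V \<Longrightarrow> (\<Sum>w\<in>V. F v w * x w) = 0"
  shows "det (mat_on V V F) = 0"
proof -
  let ?x = "vec (card V) (\<lambda>j. x (from_nat_into V j))"
  have "mat_on V V F *\<^sub>v ?x = 0\<^sub>v (card V)"
  proof (rule eq_vecI)
    fix i assume "i < dim_vec (0\<^sub>v (card V) :: 'b vec)"
    then show "(mat_on V V F *\<^sub>v ?x) $ i = 0\<^sub>v (card V) $ i"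
      using kernel[of "from_nat_into V i"]
        sum.card_from_nat_into[of "\<lambda>u. F (from_nat_into V i) u * x u" V]
      by (simp add: mat_on_def scalar_prod_def atLeast0LessThan from_nat_into_less_card)
  qed (simp add: mat_on_def)
  moreover have "?x \<noteq> 0\<^sub>v (card V)"
  proof
    assume zero: "?x = 0\<^sub>v (card V)"
    obtain i where i: "i < card V" "v = from_nat_into V i"
      using bij_betw_from_nat_into_finite[OF assms(1)] assms(2) by (auto simp: bij_betw_def)
    then have "x v = ?x $ i"
      by simp
    also have "\<dots> = 0"
      unfolding zero using i(1) by simp
    finally show False
      using assms(3) by simp
  qed
  ultimately show ?thesis
    unfolding det_0_iff_vec_prod_zero[OF mat_on_carrier] by (intro exI[of _ ?x]) simp
qed

lemma det_four_block_mat_one_lower_right: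
  fixes A B C :: "'a :: idom mat"
  assumes A: "A \<in> carrier_mat n n" and B: "B \<in> carrier_mat n m" and C: "C \<in> carrier_mat m n"
  shows "det (four_block_mat A B C (1\<^sub>m m)) = det (A - B * C)"
proof -
  let ?M = "four_block_mat A B C (1\<^sub>m m)"
  let ?L = "four_block_mat (1\<^sub>m n) (0\<^sub>m n m) (- C) (1\<^sub>m m)"
  have carrier: "?M \<in> carrier_mat (n + m) (n + m)" "?L \<in> carrier_mat (n + m) (n + m)"
    using A by auto
  have "?M * ?L = four_block_mat (A * 1\<^sub>m n + B * - C) (A * 0\<^sub>m n m + B * 1\<^sub>m m)
      (C * 1\<^sub>m n + 1\<^sub>m m * - C) (C * 0\<^sub>m n m + 1\<^sub>m m * 1\<^sub>m m)"
    using A B C by (intro mult_four_block_mat) auto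
  also have "\<dots> = four_block_mat (A - B * C) B (0\<^sub>m m n) (1\<^sub>m m)"
    using A B C by (intro cong_four_block_mat) auto
  finally have "?M * ?L = four_block_mat (A - B * C) B (0\<^sub>m m n) (1\<^sub>m m)" .
  moreover have "det (four_block_mat (A - B * C) B (0\<^sub>m m n) (1\<^sub>m m)) = det (A - B * C)"
    using A B C by (subst det_four_block_mat_lower_left_zero[where n = n and m = m]) auto
  moreover have "det ?L = 1"
    using C by (subst det_four_block_mat_upper_right_zero[where n = n and m = m]) auto
  ultimately show ?thesis
    using det_mult[OF carrier] by simp
qed

lemma det_four_block_mat_smult_one_upper_left:
  fixes B C D :: "'a :: idom mat"
  assumes B: "B \<in> carrier_mat n m" and C: "C \<in> carrier_mat m n" and D: "D \<in> carrier_mat m m"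
  shows "y ^ m * det (four_block_mat (y \<cdot>\<^sub>m 1\<^sub>m n) B C D) = y ^ n * det (y \<cdot>\<^sub>m D - C * B)"
proof -
  let ?M = "four_block_mat (y \<cdot>\<^sub>m 1\<^sub>m n) B C D"
  let ?K = "four_block_mat (1\<^sub>m n) (0\<^sub>m n m) (- C) (y \<cdot>\<^sub>m 1\<^sub>m m)"
  have carrier: "?M \<in> carrier_mat (n + m) (n + m)" "?K \<in> carrier_mat (n + m) (n + m)"
    using D by auto
  have "?K * ?M = four_block_mat (1\<^sub>m n * (y \<cdot>\<^sub>m 1\<^sub>m n) + 0\<^sub>m n m * C) (1\<^sub>m n * B + 0\<^sub>m n m * D)
      (- C * (y \<cdot>\<^sub>m 1\<^sub>m n) + y \<cdot>\<^sub>m 1\<^sub>m m * C) (- C * B + y \<cdot>\<^sub>m 1\<^sub>m m * D)"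
    using B C D by (intro mult_four_block_mat) auto
  also have "\<dots> = four_block_mat (y \<cdot>\<^sub>m 1\<^sub>m n) B (0\<^sub>m m n) (y \<cdot>\<^sub>m D - C * B)"
  proof (rule cong_four_block_mat)
    have scaled: "C * (y \<cdot>\<^sub>m 1\<^sub>m n) = y \<cdot>\<^sub>m C" "y \<cdot>\<^sub>m 1\<^sub>m m * C = y \<cdot>\<^sub>m C"
      "y \<cdot>\<^sub>m 1\<^sub>m m * D = y \<cdot>\<^sub>m D"
      using C D by (simp_all add: mult_smult_distrib[OF C one_carrier_mat]
          mult_smult_assoc_mat[OF one_carrier_mat])
    show "- C * (y \<cdot>\<^sub>m 1\<^sub>m n) + y \<cdot>\<^sub>m 1\<^sub>m m * C = 0\<^sub>m m n"
      using C by (simp add: scaled)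
    show "- C * B + y \<cdot>\<^sub>m 1\<^sub>m m * D = y \<cdot>\<^sub>m D - C * B"
      using B C D by (auto simp: scaled)
  qed (use B C D in auto)
  finally have "?K * ?M = four_block_mat (y \<cdot>\<^sub>m 1\<^sub>m n) B (0\<^sub>m m n) (y \<cdot>\<^sub>m D - C * B)" .
  moreover have "det (four_block_mat (y \<cdot>\<^sub>m 1\<^sub>m n) B (0\<^sub>m m n) (y \<cdot>\<^sub>m D - C * B))
      = y ^ n * det (y \<cdot>\<^sub>m D - C * B)"
    using B C D by (subst det_four_block_mat_lower_left_zero[where n = n and m = m]) auto
  moreover have "det ?K = y ^ m"
    using C by (subst det_four_block_mat_upper_right_zero[where n = n and m = m]) auto
  ultimately show ?thesis
    using det_mult[OF carrier(2,1)] by simp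
qed

text \<open>
  Both sides evaluate the determinant of the block matrix with rows \<open>(y I, A)\<close> and \<open>(C, I)\<close>:
  column operations clear \<open>C\<close> for the left-hand side, row operations for the right-hand side.
\<close>

lemma sylvester_determinant_identity:
  fixes A C :: "'a :: idom mat"
  assumes A: "A \<in> carrier_mat n m" and C: "C \<in> carrier_mat m n"
  shows "y ^ m * det (y \<cdot>\<^sub>m 1\<^sub>m n - A * C) = y ^ n * det (y \<cdot>\<^sub>m 1\<^sub>m m - C * A)"
proof -
  have "det (y \<cdot>\<^sub>m 1\<^sub>m n - A * C) = det (four_block_mat (y \<cdot>\<^sub>m 1\<^sub>m n) A C (1\<^sub>m m))"
    using A C by (subst det_four_block_mat_one_lower_right) auto
  then show ?thesis
    using det_four_block_mat_smult_one_upper_left[OF A C one_carrier_mat] by simp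
qed

section \<open>The forest expansion of the Laplacian determinant\<close>

definition laplacian :: "'a set \<Rightarrow> 'a set set \<Rightarrow> 'a \<Rightarrow> 'a \<Rightarrow> 'b :: comm_ring_1" where
  "laplacian V E v w =
    of_bool (v = w) * of_nat (card {u \<in> V. {v, u} \<in> E}) - of_bool ({v, w} \<in> E)"

text \<open>
  The vertices from which the parent function never reaches a root are closed under taking parents
  and children.
\<close>

lemma indicator_unrooted_in_kernel:
  assumes "finite V" and f: "f \<in> parent_funs V E" and v: "v \<in> V"
  defines "S \<equiv> - Wellfounded.acc (parent_rel V f)"
  shows "(\<Sum>w\<in>V. (of_bool (v = w) - of_bool (f v = Some w)) * of_bool (w \<in> S))
    = (0 :: 'b :: comm_ring_1)"
proof -
  have parent_in_S: "v \<in> S \<longleftrightarrow> (\<exists>u. f v = Some u \<and> u \<in> S)"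
    using v acc_downward[of v "parent_rel V f"]
    by (auto simp: S_def parent_rel_def elim: not_acc_down)
  have "(\<Sum>w\<in>V. (of_bool (v = w) - of_bool (f v = Some w)) * of_bool (w \<in> S))
      = (\<Sum>w\<in>V. of_bool (v = w) * of_bool (w \<in> S))
        - (\<Sum>w\<in>V. of_bool (f v = Some w) * of_bool (w \<in> S) :: 'b)"
    by (simp add: left_diff_distrib sum_subtractf)
  also have "(\<Sum>w\<in>V. of_bool (v = w) * of_bool (w \<in> S) :: 'b) = of_bool (v \<in> S)"
    using assms(1) v by (simp add: sum_of_bool_mult_eq)
  also have "(\<Sum>w\<in>V. of_bool (f v = Some w) * of_bool (w \<in> S) :: 'b) = of_bool (v \<in> S)"
  proof (cases "f v")
    case None
    with parent_in_S show ?thesis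
      by simp
  next
    case (Some u)
    then have "u \<in> V"
      using parent_relD(1)[OF f, of u v] v by (simp add: parent_rel_def)
    with assms(1) Some parent_in_S show ?thesis
      by (simp add: sum_of_bool_mult_eq)
  qed
  finally show ?thesis
    by simp
qed

lemma det_parent_mat:
  assumes "finite V" and f: "f \<in> parent_funs V E"
  shows "det (mat_on V V (\<lambda>v w. of_bool (v = w) - of_bool (f v = Some w)) :: 'b :: idom mat)
    = of_bool (wf (parent_rel V f))"
    (is "det (mat_on V V ?F) = _")
proof (cases "wf (parent_rel V f)")
  case True
  then have "f v \<noteq> Some v" if "v \<in> V" for v
    using that wf_not_refl[of "parent_rel V f" v] by (auto simp: parent_rel_def)
  then have "(\<Prod>v\<in>V. ?F v v) = 1"
    by simp
  moreover have "det (mat_on V V ?F) = (\<Prod>v\<in>V. ?F v v)"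
    using assms(1) True by (rule det_mat_on_triangular) (auto simp: parent_rel_def)
  ultimately show ?thesis
    using True by simp
next
  case False
  then obtain s where s: "s \<notin> Wellfounded.acc (parent_rel V f)"
    by (auto simp: wf_iff_acc)
  then have "s \<in> V"
    by (auto simp: parent_rel_def elim: not_acc_down)
  have "det (mat_on V V ?F) = 0"
  proof (rule det_mat_on_eq_0[OF assms(1) \<open>s \<in> V\<close>])
    show "of_bool (s \<in> - Wellfounded.acc (parent_rel V f)) \<noteq> (0 :: 'b)"
      using s by simp
  qed (rule indicator_unrooted_in_kernel[OF assms])
  with False show ?thesis
    by simp
qed

text \<open>
  A row of \<open>x I + L\<close> has one summand for each choice of a parent, so multilinearity in the rows
  turns the determinant into a sum over parent functions.
\<close>

lemma laplacian_row_expansion: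
  assumes "finite V" "w \<in> V"
  shows "x * of_bool (v = w) + laplacian V E v w
    = (\<Sum>c\<in>parent_choices V E v.
        (if c = None then x else 1) * (of_bool (v = w) - of_bool (c = Some w)))"
proof -
  have "(\<Sum>c\<in>parent_choices V E v.
        (if c = None then x else 1) * (of_bool (v = w) - of_bool (c = Some w)))
      = x * of_bool (v = w) + (\<Sum>u | u \<in> V \<and> {v, u} \<in> E. of_bool (v = w) - of_bool (u = w))"
    unfolding parent_choices_def using assms(1) by (subst sum.insert) (auto simp: sum.reindex)
  also have "(\<Sum>u | u \<in> V \<and> {v, u} \<in> E. of_bool (v = w) - of_bool (u = w))
      = laplacian V E v w"
    using assms by (simp add: laplacian_def sum_subtractf mult.commute of_bool_def)
  finally show ?thesis
    by simp
qed

lemma det_laplacian_eq_sum_rooted_forests: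
  fixes x :: "'b :: idom"
  assumes "finite V"
  shows "det (x \<cdot>\<^sub>m 1\<^sub>m (card V) + mat_on V V (laplacian V E))
    = (\<Sum>f\<in>rooted_forests V E. x ^ card (roots V f))"
proof -
  let ?C = "parent_choices V E"
  let ?x = "\<lambda>c :: 'a option. if c = None then x else 1"
  let ?F = "\<lambda>f v w. of_bool (v = w) - of_bool (f v = Some w) :: 'b"
  have "x \<cdot>\<^sub>m 1\<^sub>m (card V) + mat_on V V (laplacian V E)
      = mat_on V V (\<lambda>v w. \<Sum>c\<in>?C v. ?x c * (of_bool (v = w) - of_bool (c = Some w)))"
    unfolding smult_one_eq_mat_on[OF assms] add_mat_on
    by (rule mat_on_cong) (rule laplacian_row_expansion[OF assms])
  then have "det (x \<cdot>\<^sub>m 1\<^sub>m (card V) + mat_on V V (laplacian V E))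
      = det (mat_on V V (\<lambda>v w. \<Sum>c\<in>?C v. ?x c * (of_bool (v = w) - of_bool (c = Some w))))"
    by (rule arg_cong)
  also have "\<dots> = (\<Sum>f\<in>parent_funs V E. det (mat_on V V (\<lambda>v w. ?x (f v) * ?F f v w)))"
    unfolding parent_funs_def using assms by (intro det_mat_on_sum_rows finite_parent_choices)
  also have "\<dots> = (\<Sum>f\<in>parent_funs V E. x ^ card (roots V f) * of_bool (wf (parent_rel V f)))"
  proof (rule sum.cong[OF refl])
    fix f assume "f \<in> parent_funs V E"
    moreover have "(\<Prod>v\<in>V. ?x (f v)) = x ^ card (roots V f)"
      using assms by (simp add: prod.If_cases roots_def Int_def)
    ultimately show "det (mat_on V V (\<lambda>v w. ?x (f v) * ?F f v w))
        = x ^ card (roots V f) * of_bool (wf (parent_rel V f))"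
      using det_parent_mat[OF assms, of f E, where 'b = 'b]
      by (simp add: det_mat_on_smult_rows[OF assms])
  qed
  also have "\<dots> = (\<Sum>f\<in>rooted_forests V E. x ^ card (roots V f))"
    using finite_parent_funs[OF assms]
    by (intro sum.mono_neutral_cong_right) (auto simp: rooted_forests_def)
  finally show ?thesis .
qed

definition forest_poly :: "'a set \<Rightarrow> 'a set set \<Rightarrow> int poly" where
  "forest_poly V E = (\<Sum>f\<in>rooted_forests V E. monom 1 (card (roots V f)))"

lemma det_laplacian_eq_forest_poly:
  assumes "finite V"
  shows "det (monom 1 1 \<cdot>\<^sub>m 1\<^sub>m (card V) + mat_on V V (laplacian V E)) = forest_poly V E"
  by (simp add: det_laplacian_eq_sum_rooted_forests[OF assms] forest_poly_def monom_power)

lemma coeff_forest_poly: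
  assumes "finite V"
  shows "coeff (forest_poly V E) k = int (card {f \<in> rooted_forests V E. card (roots V f) = k})"
  using finite_rooted_forests[OF assms]
  by (simp add: forest_poly_def coeff_sum sum.If_cases Int_def)

lemma coeff_0_forest_poly:
  assumes "finite V" "V \<noteq> {}"
  shows "coeff (forest_poly V E) 0 = 0"
proof -
  have "finite (roots V f)" for f
    using assms(1) by (simp add: roots_def)
  then have "{f \<in> rooted_forests V E. card (roots V f) = 0} = {}"
    using roots_nonempty[OF _ assms(2)] by auto
  then show ?thesis
    by (simp only: coeff_forest_poly[OF assms(1)] card.empty of_nat_0)
qed

lemma coeff_1_forest_poly:
  assumes "finite V" "\<And>e. e \<in> E \<Longrightarrow> e \<subseteq> V \<and> card e = 2"
  shows "coeff (forest_poly V E) 1 = int (card (rooted_spanning_trees V E))"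
proof -
  have "coeff (forest_poly V E) 1 = int (card (rooted_trees V E))"
    unfolding coeff_forest_poly[OF assms(1)] rooted_trees_def ..
  also have "\<dots> = int (card (rooted_spanning_trees V E))"
    by (simp only: bij_betw_same_card[OF bij_betw_rooted_trees_rooted_spanning_trees[OF assms]])
  finally show ?thesis .
qed

section \<open>Regular partial linear spaces\<close>

definition collinearity_edges :: "'a set \<Rightarrow> 'b set \<Rightarrow> ('a \<Rightarrow> 'b \<Rightarrow> bool) \<Rightarrow> 'a set set" where
  "collinearity_edges P L I =
    {{p, q} | p q. p \<in> P \<and> q \<in> P \<and> p \<noteq> q \<and> (\<exists>l\<in>L. I p l \<and> I q l)}"

definition two_step_walks ::
    "'a set \<Rightarrow> 'b set \<Rightarrow> ('a \<Rightarrow> 'b \<Rightarrow> bool) \<Rightarrow> 'a \<Rightarrow> ('b \<times> 'a) set" where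
  "two_step_walks P L I p = {(l, q) \<in> L \<times> P. I p l \<and> I q l}"

lemma collinearity_edge_iff:
  "{p, q} \<in> collinearity_edges P L I \<longleftrightarrow>
    p \<in> P \<and> q \<in> P \<and> p \<noteq> q \<and> (\<exists>l\<in>L. I p l \<and> I q l)"
  by (auto simp: collinearity_edges_def doubleton_eq_iff)

lemma collinearity_edge_subset_card:
  "e \<in> collinearity_edges P L I \<Longrightarrow> e \<subseteq> P \<and> card e = 2"
  by (auto simp: collinearity_edges_def)

lemma finite_rooted_spanning_trees:
  assumes "finite V" "E \<subseteq> Pow V"
  shows "finite (rooted_spanning_trees V E)"
proof (rule finite_subset)
  show "rooted_spanning_trees V E \<subseteq> Pow (Pow V) \<times> V"
    using assms(2) by (auto simp: rooted_spanning_trees_def spanning_tree_def)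
qed (use assms(1) in simp)

locale regular_partial_linear_space =
  fixes P :: "'a set" and L :: "'b set" and I :: "'a \<Rightarrow> 'b \<Rightarrow> bool" and r k :: nat
  assumes finite_points: "finite P" and finite_lines: "finite L"
    and points_nonempty: "P \<noteq> {}" and lines_nonempty: "L \<noteq> {}"
    and card_lines_through: "p \<in> P \<Longrightarrow> card {l \<in> L. I p l} = r"
    and card_points_on: "l \<in> L \<Longrightarrow> card {p \<in> P. I p l} = k"
    and unique_common_line:
      "\<lbrakk>p \<in> P; q \<in> P; p \<noteq> q; l \<in> L; l' \<in> L; I p l; I q l; I p l'; I q l'\<rbrakk> \<Longrightarrow> l = l'"
begin

abbreviation collinearity :: "'a set set" where
  "collinearity \<equiv> collinearity_edges P L I"

abbreviation concurrency :: "'b set set" where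
  "concurrency \<equiv> collinearity_edges L P (\<lambda>l p. I p l)"

text \<open>
  The axiom \<open>unique_common_line\<close> is self-dual, as it excludes two points on two common lines.
\<close>

lemma dual: "regular_partial_linear_space L P (\<lambda>l p. I p l) k r"
  using finite_points finite_lines points_nonempty lines_nonempty card_lines_through
    card_points_on unique_common_line
  by unfold_locales blast+

lemma card_common_lines:
  assumes "p \<in> P" "q \<in> P" "p \<noteq> q"
  shows "card {l \<in> L. I p l \<and> I q l} = of_bool ({p, q} \<in> collinearity)"
proof (cases "\<exists>l\<in>L. I p l \<and> I q l")
  case True
  then obtain l where "l \<in> L" "I p l" "I q l"
    by blast
  with assms unique_common_line have "{l \<in> L. I p l \<and> I q l} = {l}"
    by blast
  with True assms show ?thesis
    by (simp add: collinearity_edge_iff)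
next
  case False
  then have "{l \<in> L. I p l \<and> I q l} = {}"
    by blast
  with False show ?thesis
    by (simp only: collinearity_edge_iff card.empty) simp
qed

lemma card_two_step_walks:
  assumes "p \<in> P"
  shows "card (two_step_walks P L I p) = r * k"
proof -
  have "two_step_walks P L I p = (SIGMA l:{l \<in> L. I p l}. {q \<in> P. I q l})"
    by (auto simp: two_step_walks_def)
  then have "card (two_step_walks P L I p) = (\<Sum>l\<in>{l \<in> L. I p l}. card {q \<in> P. I q l})"
    using finite_points finite_lines by simp
  also have "\<dots> = r * k"
    using card_points_on card_lines_through[OF assms] by simp
  finally show ?thesis .
qed

lemma card_collinear_points:
  assumes p: "p \<in> P"
  shows "card {q \<in> P. {p, q} \<in> collinearity} + r = r * k"
proof -
  have "r * k = card (SIGMA q:P. {l \<in> L. I p l \<and> I q l})"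
    unfolding card_two_step_walks[OF p, symmetric]
    by (rule bij_betw_same_card[of prod.swap], rule bij_betw_byWitness[of _ prod.swap])
      (auto simp: two_step_walks_def)
  also have "\<dots> = (\<Sum>q\<in>P. card {l \<in> L. I p l \<and> I q l})"
    using finite_points finite_lines by simp
  also have "\<dots> = r + (\<Sum>q\<in>P - {p}. card {l \<in> L. I p l \<and> I q l})"
    using card_lines_through[OF p] by (simp add: sum.remove[OF finite_points p])
  also have "(\<Sum>q\<in>P - {p}. card {l \<in> L. I p l \<and> I q l})
      = (\<Sum>q\<in>P - {p}. of_bool ({p, q} \<in> collinearity))"
    using p by (intro sum.cong) (auto simp: card_common_lines)
  also have "\<dots> = card {q \<in> P. {p, q} \<in> collinearity}"
    using finite_points
    by (simp add: sum_of_bool_eq) (auto simp: collinearity_edge_iff intro: arg_cong[where f = card])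
  finally show ?thesis
    by simp
qed

lemma laplacian_collinearity_eq_gram:
  fixes x :: "'c :: comm_ring_1"
  shows "x \<cdot>\<^sub>m 1\<^sub>m (card P) + mat_on P P (laplacian P collinearity)
    = (x + of_nat (r * k)) \<cdot>\<^sub>m 1\<^sub>m (card P)
      - mat_on P L (\<lambda>p l. of_bool (I p l)) * mat_on L P (\<lambda>l p. of_bool (I p l))"
proof -
  have common: "(\<Sum>l\<in>L. of_bool (I p l) * of_bool (I q l))
      = (of_nat (card {l \<in> L. I p l \<and> I q l}) :: 'c)" for p q
    using finite_lines by (simp only: of_bool_conj[symmetric]) (simp add: sum_of_bool_eq Int_def)
  have "x * of_bool (p = q) + laplacian P collinearity p q
      = (x + of_nat (r * k)) * of_bool (p = q) - (\<Sum>l\<in>L. of_bool (I p l) * of_bool (I q l))"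
    if "p \<in> P" "q \<in> P" for p q
  proof (cases "p = q")
    case True
    moreover have "{p} \<notin> collinearity"
      using collinearity_edge_iff[of p p] by simp
    ultimately show ?thesis
      unfolding common card_collinear_points[OF that(1), symmetric]
      using that card_lines_through by (simp add: laplacian_def)
  next
    case False
    then show ?thesis
      unfolding common using card_common_lines[OF that False] by (simp add: laplacian_def)
  qed
  then show ?thesis
    unfolding smult_one_eq_mat_on[OF finite_points] mult_mat_on add_mat_on minus_mat_on
    by (rule mat_on_cong)
qed

lemma forest_poly_collinearity:
  "forest_poly P collinearity * (monom 1 1 + of_nat (r * k)) ^ card L
    = forest_poly L concurrency * (monom 1 1 + of_nat (r * k)) ^ card P"
proof -
  interpret dual: regular_partial_linear_space L P "\<lambda>l p. I p l" k r
    by (rule dual)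
  let ?y = "monom 1 1 + of_nat (r * k) :: int poly"
  let ?A = "mat_on P L (\<lambda>p l. of_bool (I p l)) :: int poly mat"
  let ?AT = "mat_on L P (\<lambda>l p. of_bool (I p l)) :: int poly mat"
  have "forest_poly P collinearity = det (?y \<cdot>\<^sub>m 1\<^sub>m (card P) - ?A * ?AT)"
    by (simp only: det_laplacian_eq_forest_poly[OF finite_points, symmetric]
        laplacian_collinearity_eq_gram)
  moreover have "forest_poly L concurrency = det (?y \<cdot>\<^sub>m 1\<^sub>m (card L) - ?AT * ?A)"
    by (simp only: det_laplacian_eq_forest_poly[OF finite_lines, symmetric]
        dual.laplacian_collinearity_eq_gram mult.commute[of k r])
  ultimately show ?thesis
    using sylvester_determinant_identity[OF mat_on_carrier mat_on_carrier]
    by (simp add: mult.commute)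
qed

lemma coeff_1_forest_poly_collinearity:
  "coeff (forest_poly P collinearity) 1
    = int (card (rooted_spanning_trees P collinearity))"
  by (rule coeff_1_forest_poly[OF finite_points]) (rule collinearity_edge_subset_card)

lemma card_rooted_spanning_trees_collinearity:
  "card (rooted_spanning_trees P collinearity) * (r * k) ^ card L
    = card (rooted_spanning_trees L concurrency) * (r * k) ^ card P"
proof -
  interpret dual: regular_partial_linear_space L P "\<lambda>l p. I p l" k r
    by (rule dual)
  let ?p = "forest_poly P collinearity"
  let ?q = "forest_poly L concurrency"
  let ?y = "monom 1 1 + of_nat (r * k) :: int poly"
  have "coeff (p * ?y ^ j) 1 = coeff p 1 * int (r * k) ^ j" if "coeff p 0 = 0" for p j
    using that by (simp add: coeff_mult coeff_0_power of_nat_poly)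
  moreover have "coeff ?p 0 = 0" "coeff ?q 0 = 0"
    by (rule coeff_0_forest_poly[OF finite_points points_nonempty]
        coeff_0_forest_poly[OF finite_lines lines_nonempty])+
  moreover have "coeff (?p * ?y ^ card L) 1 = coeff (?q * ?y ^ card P) 1"
    by (simp only: forest_poly_collinearity)
  ultimately have "coeff ?p 1 * int (r * k) ^ card L = coeff ?q 1 * int (r * k) ^ card P"
    by simp
  then show ?thesis
    unfolding coeff_1_forest_poly_collinearity dual.coeff_1_forest_poly_collinearity
    by (simp only: of_nat_eq_iff flip: of_nat_power of_nat_mult)
qed

lemma card_PiE_two_step_walks: "card (\<Pi>\<^sub>E p\<in>P. two_step_walks P L I p) = (r * k) ^ card P"
  by (simp add: card_PiE finite_points card_two_step_walks)

lemma finite_PiE_two_step_walks: "finite (\<Pi>\<^sub>E p\<in>P. two_step_walks P L I p)"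
proof (intro finite_PiE)
  show "finite (two_step_walks P L I p)" for p
    by (rule finite_subset[of _ "L \<times> P"])
      (auto simp: two_step_walks_def finite_points finite_lines)
qed (fact finite_points)

lemma rooted_spanning_trees_collinearity_eqpoll:
  "rooted_spanning_trees P collinearity
      \<times> (\<Pi>\<^sub>E l\<in>L. two_step_walks L P (\<lambda>l p. I p l) l)
    \<approx> rooted_spanning_trees L concurrency
      \<times> (\<Pi>\<^sub>E p\<in>P. two_step_walks P L I p)" (is "?A \<approx> ?B")
proof -
  interpret dual: regular_partial_linear_space L P "\<lambda>l p. I p l" k r
    by (rule dual)
  have "finite (rooted_spanning_trees P collinearity)"
    "finite (rooted_spanning_trees L concurrency)"
    using collinearity_edge_subset_card finite_points finite_lines
    by (blast intro: finite_rooted_spanning_trees)+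
  then have "finite ?A" "finite ?B"
    using finite_PiE_two_step_walks dual.finite_PiE_two_step_walks by auto
  moreover have "card ?A = card ?B"
    unfolding card_cartesian_product card_PiE_two_step_walks dual.card_PiE_two_step_walks
      mult.commute[of k r]
    by (rule card_rooted_spanning_trees_collinearity)
  ultimately show ?thesis
    by (simp add: eqpoll_iff_card)
qed

end

section \<open>Johnson graphs\<close>

lemma finite_B: "finite (B n k)"
  by (simp add: B_def)

lemma B_memD:
  assumes "X \<in> B n k"
  shows "X \<subseteq> {1..n}" "card X = k" "finite X"
  using assms finite_subset[of X "{1..n}"] by (auto simp: B_def)

lemma B_nonempty: "k \<le> n \<Longrightarrow> B n k \<noteq> {}"
  using obtain_subset_with_card_n[of k "{1..n}"] by (auto simp: B_def)

lemma card_B_subsets: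
  assumes "X \<in> B n j"
  shows "card {Y \<in> B n k. Y \<subseteq> X} = j choose k"
proof -
  have "{Y \<in> B n k. Y \<subseteq> X} = {Y. Y \<subseteq> X \<and> card Y = k}"
    using B_memD(1)[OF assms] by (auto simp: B_def)
  then show ?thesis
    using n_subsets[OF B_memD(3)[OF assms], of k] B_memD(2)[OF assms] by simp
qed

lemma card_B_supersets_Suc:
  assumes X: "X \<in> B n k"
  shows "card {Y \<in> B n (Suc k). X \<subseteq> Y} = n - k"
proof -
  have "{Y \<in> B n (Suc k). X \<subseteq> Y} = (\<lambda>a. insert a X) ` ({1..n} - X)"
  proof (intro equalityI subsetI)
    fix Y assume "Y \<in> {Y \<in> B n (Suc k). X \<subseteq> Y}"
    then have Y: "Y \<in> B n (Suc k)" "X \<subseteq> Y"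
      by auto
    then have "card (Y - X) = 1"
      using B_memD[OF X] B_memD(2)[OF Y(1)] by (simp add: card_Diff_subset)
    then obtain a where "Y - X = {a}"
      by (auto simp: card_1_singleton_iff)
    with Y B_memD(1)[OF Y(1)] show "Y \<in> (\<lambda>a. insert a X) ` ({1..n} - X)"
      by (intro image_eqI[of _ _ a]) auto
  qed (use B_memD[OF X] in \<open>auto simp: B_def\<close>)
  moreover have "inj_on (\<lambda>a. insert a X) ({1..n} - X)"
    by (auto intro!: inj_onI)
  ultimately show ?thesis
    using B_memD[OF X] by (simp add: card_image card_Diff_subset)
qed

lemma card_Int_less:
  assumes "X \<in> B n k" "Y \<in> B n k" "X \<noteq> Y"
  shows "card (X \<inter> Y) < k"
proof -
  have "\<not> X \<subseteq> Y"
    using card_subset_eq[of Y X] B_memD[OF assms(1)] B_memD[OF assms(2)] assms(3) by auto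
  then have "X \<inter> Y \<subset> X"
    by blast
  then show ?thesis
    using psubset_card_mono[of X "X \<inter> Y"] B_memD[OF assms(1)] by simp
qed

lemma common_subset_eq_Int:
  assumes X: "X \<in> B n (Suc k)" "X' \<in> B n (Suc k)" "X \<noteq> X'"
    and Y: "Y \<in> B n k" "Y \<subseteq> X" "Y \<subseteq> X'"
  shows "Y = X \<inter> X'"
proof (rule card_seteq)
  show "card (X \<inter> X') \<le> card Y"
    using card_Int_less[OF X] B_memD(2)[OF Y(1)] by simp
qed (use Y B_memD(3)[OF X(1)] in auto)

lemma johnson_edges_Suc_eq_collinearity_subsets:
  "johnson_edges n (Suc k) = collinearity_edges (B n (Suc k)) (B n k) (\<lambda>X Y. Y \<subseteq> X)"
  unfolding johnson_edges_def collinearity_edges_def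
proof (intro Collect_cong ex_cong1 conj_cong refl)
  fix X X' assume X: "X \<in> B n (Suc k)" "X' \<in> B n (Suc k)"
  show "int (card (X \<inter> X')) = int (Suc k) - 1
      \<longleftrightarrow> X \<noteq> X' \<and> (\<exists>Y\<in>B n k. Y \<subseteq> X \<and> Y \<subseteq> X')"
  proof
    assume "int (card (X \<inter> X')) = int (Suc k) - 1"
    then have card: "card (X \<inter> X') = k"
      by simp
    then have "X \<inter> X' \<in> B n k"
      using B_memD(1)[OF X(1)] by (auto simp: B_def)
    moreover have "X \<noteq> X'"
      using card B_memD(2)[OF X(1)] by auto
    ultimately show "X \<noteq> X' \<and> (\<exists>Y\<in>B n k. Y \<subseteq> X \<and> Y \<subseteq> X')"
      by blast
  next
    assume "X \<noteq> X' \<and> (\<exists>Y\<in>B n k. Y \<subseteq> X \<and> Y \<subseteq> X')"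
    then obtain Y where "X \<noteq> X'" and Y: "Y \<in> B n k" "Y \<subseteq> X" "Y \<subseteq> X'"
      by blast
    then have "Y = X \<inter> X'"
      by (intro common_subset_eq_Int[OF X])
    then show "int (card (X \<inter> X')) = int (Suc k) - 1"
      using B_memD(2)[OF Y(1)] by simp
  qed
qed

lemma johnson_edges_eq_collinearity_supersets:
  "johnson_edges n k = collinearity_edges (B n k) (B n (Suc k)) (\<lambda>X Y. X \<subseteq> Y)"
  unfolding johnson_edges_def collinearity_edges_def
proof (intro Collect_cong ex_cong1 conj_cong refl)
  fix X X' assume X: "X \<in> B n k" "X' \<in> B n k"
  have sum: "card (X \<union> X') + card (X \<inter> X') = 2 * k"
    using card_Un_Int[of X X'] B_memD[OF X(1)] B_memD[OF X(2)] by simp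
  show "int (card (X \<inter> X')) = int k - 1
      \<longleftrightarrow> X \<noteq> X' \<and> (\<exists>Y\<in>B n (Suc k). X \<subseteq> Y \<and> X' \<subseteq> Y)"
  proof
    assume "int (card (X \<inter> X')) = int k - 1"
    then have card: "card (X \<union> X') = Suc k"
      using sum by simp
    then have "X \<union> X' \<in> B n (Suc k)"
      using B_memD(1)[OF X(1)] B_memD(1)[OF X(2)] by (auto simp: B_def)
    moreover have "X \<noteq> X'"
      using card B_memD(2)[OF X(1)] by auto
    ultimately show "X \<noteq> X' \<and> (\<exists>Y\<in>B n (Suc k). X \<subseteq> Y \<and> X' \<subseteq> Y)"
      by blast
  next
    assume "X \<noteq> X' \<and> (\<exists>Y\<in>B n (Suc k). X \<subseteq> Y \<and> X' \<subseteq> Y)"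
    then obtain Y where "X \<noteq> X'" and Y: "Y \<in> B n (Suc k)" "X \<union> X' \<subseteq> Y"
      by auto
    have "card (X \<union> X') \<le> Suc k"
      using card_mono[OF B_memD(3)[OF Y(1)] Y(2)] B_memD(2)[OF Y(1)] by simp
    with sum card_Int_less[OF X \<open>X \<noteq> X'\<close>] show "int (card (X \<inter> X')) = int k - 1"
      by linarith
  qed
qed

lemma regular_partial_linear_space_B:
  assumes "k < n"
  shows "regular_partial_linear_space (B n (Suc k)) (B n k) (\<lambda>X Y. Y \<subseteq> X) (Suc k) (n - k)"
proof
  show "card {Y \<in> B n k. Y \<subseteq> X} = Suc k" if "X \<in> B n (Suc k)" for X
    using card_B_subsets[OF that, of k] by simp
  show "Y = Y'"
    if "X \<in> B n (Suc k)" "X' \<in> B n (Suc k)" "X \<noteq> X'" "Y \<in> B n k" "Y' \<in> B n k"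
      "Y \<subseteq> X" "Y \<subseteq> X'" "Y' \<subseteq> X" "Y' \<subseteq> X'" for X X' Y Y'
    using common_subset_eq_Int[OF that(1-3) that(4,6,7)]
      common_subset_eq_Int[OF that(1-3) that(5,8,9)] by simp
qed (use assms in \<open>simp_all add: finite_B B_nonempty card_B_supersets_Suc\<close>)

theorem theorem3p4:
  fixes n m :: nat
  assumes "1 \<le> m" and "2 * m \<le> n"
  shows "T n m \<times> (\<Pi>\<^sub>E X \<in> B n (m - 1). DU n m X) \<approx> T n (m - 1) \<times> (\<Pi>\<^sub>E X \<in> B n m. UD n m X)"
proof -
  obtain k where m: "m = Suc k"
    using assms(1) by (cases m) auto
  interpret regular_partial_linear_space "B n (Suc k)" "B n k" "\<lambda>X Y. Y \<subseteq> X" "Suc k" "n - k"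
    using assms(2) by (intro regular_partial_linear_space_B) (simp add: m)
  have "T n (Suc k) = rooted_spanning_trees (B n (Suc k))
      (collinearity_edges (B n (Suc k)) (B n k) (\<lambda>X Y. Y \<subseteq> X))"
    by (simp only: T_def johnson_edges_Suc_eq_collinearity_subsets)
  moreover have "T n k = rooted_spanning_trees (B n k)
      (collinearity_edges (B n k) (B n (Suc k)) (\<lambda>X Y. X \<subseteq> Y))"
    by (simp only: T_def johnson_edges_eq_collinearity_supersets)
  moreover have "UD n (Suc k) = two_step_walks (B n (Suc k)) (B n k) (\<lambda>X Y. Y \<subseteq> X)"
    "DU n (Suc k) = two_step_walks (B n k) (B n (Suc k)) (\<lambda>X Y. X \<subseteq> Y)"
    by (simp_all add: fun_eq_iff UD_def DU_def two_step_walks_def)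
  ultimately show ?thesis
    using rooted_spanning_trees_collinearity_eqpoll by (simp add: m)
qed

end
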